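(* Let $\Bbbk$ be an algebraically closed field with $\operatorname{char}(\Bbbk)=p>0$, let $q\in\Bbbk$ be a primitive $n$-th root of unity, and let $f\in\Bbbk[t]$. Suppose that one of the following conditions holds: (i) $n\nmid (j+1)$ for all $j\in\operatorname{supp}(f)$; or (ii) $p\mid n$. Then $u^{n},v^{n}\in Z(B_q(f))$.
   Context: For $q\in\Bbbk^{*}$ and $f\in\Bbbk[t]$, $B_q(f)$ is the associative unital $\Bbbk$-algebra generated by $u,v,w$ subject to the relations $uv=qvu$, $wu=quw+f(v)$, $wv=q^{-1}vw+f(u)$. $Z(B_q(f))$ denotes its center. For $f(t)=\sum_{j=0}^{d}c_jt^j$, the support of $f$ is $\operatorname{supp}(f)=\{\,j\mid c_j\neq 0\,\}$. *)

theory Defs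
  imports
    "HOL-Library.Poly_Mapping"
    "HOL-Algebra.QuotRing"
    "HOL-Algebra.Algebraic_Closure_Type"
begin

datatype gen = GenU | GenV | GenW

text \<open>
  Words in the three generators, as a separate type so that concatenation can be made the
  (non-commutative) addition of a \<^class>\<open>monoid_add\<close>.  The convolution product on
  finitely supported functions then makes \<open>free_word \<Rightarrow>\<^sub>0 'a\<close> the free associative
  unital algebra on the generators over the field \<open>'a\<close>.
\<close>

datatype free_word = Word "gen list"

instantiation free_word :: monoid_add
begin

definition zero_free_word :: free_word where
  "zero_free_word = Word []"

fun plus_free_word :: "free_word \<Rightarrow> free_word \<Rightarrow> free_word" where
  "plus_free_word (Word xs) (Word ys) = Word (xs @ ys)"

instance
proof
  fix a b c :: free_word
  show "a + b + c = a + (b + c)" by (cases a; cases b; cases c) simp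
  show "0 + a = a" by (cases a) (simp add: zero_free_word_def)
  show "a + 0 = a" by (cases a) (simp add: zero_free_word_def)
qed

end

type_synonym 'a free_alg = "free_word \<Rightarrow>\<^sub>0 'a"

definition scalar :: "'a::field \<Rightarrow> 'a free_alg" where
  "scalar c = Poly_Mapping.single 0 c"

definition gen :: "gen \<Rightarrow> 'a::field free_alg" where
  "gen g = Poly_Mapping.single (Word [g]) 1"

text \<open>
  \<^const>\<open>poly\<close> is only available over commutative rings, hence the explicit sum for \<open>f(x)\<close>.
\<close>

definition eval_at :: "'a::field poly \<Rightarrow> 'a free_alg \<Rightarrow> 'a free_alg" where
  "eval_at f x = (\<Sum>j\<le>Polynomial.degree f. scalar (Polynomial.coeff f j) * x ^ j)"

definition B_relations :: "'a::field \<Rightarrow> 'a poly \<Rightarrow> 'a free_alg set" where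
  "B_relations q f =
     (let u = gen GenU; v = gen GenV; w = gen GenW in
      {u * v - scalar q * (v * u),
       w * u - (scalar q * (u * w) + eval_at f v),
       w * v - (scalar (inverse q) * (v * w) + eval_at f u)})"

text \<open>
  In \<^theory>\<open>HOL-Algebra.Ideal\<close> ideals are two-sided.  As the free algebra contains the scalars,
  its ring ideals are automatically closed under scalar multiplication.
\<close>

definition B_ideal :: "'a::field \<Rightarrow> 'a poly \<Rightarrow> 'a free_alg set" where
  "B_ideal q f = genideal ring_of_type_algebra (B_relations q f)"

definition B_alg :: "'a::field \<Rightarrow> 'a poly \<Rightarrow> 'a free_alg set ring" where
  "B_alg q f = ring_of_type_algebra Quot B_ideal q f"

definition B_gen :: "'a::field \<Rightarrow> 'a poly \<Rightarrow> gen \<Rightarrow> 'a free_alg set" where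
  "B_gen q f g = a_r_coset ring_of_type_algebra (B_ideal q f) (gen g)"

definition ring_center :: "('r, 'm) ring_scheme \<Rightarrow> 'r set" where
  "ring_center R = {z \<in> carrier R. \<forall>x \<in> carrier R. z \<otimes>\<^bsub>R\<^esub> x = x \<otimes>\<^bsub>R\<^esub> z}"

definition poly_supp :: "'a::zero poly \<Rightarrow> nat set" where
  "poly_supp f = {j. Polynomial.coeff f j \<noteq> 0}"

definition primitive_root_of_unity :: "nat \<Rightarrow> 'a::field \<Rightarrow> bool" where
  "primitive_root_of_unity n q \<longleftrightarrow>
     n > 0 \<and> q ^ n = 1 \<and> (\<forall>k. 0 < k \<and> k < n \<longrightarrow> q ^ k \<noteq> 1)"

end

theory Submission
  imports Defs
begin

text \<open>
  Only the commutators of \<open>u ^ n\<close> and \<open>v ^ n\<close> with \<open>w\<close> need an argument, since moving \<open>u ^ n\<close>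
  past \<open>v\<close> or \<open>v ^ n\<close> past \<open>u\<close> costs a factor \<open>q ^ n = 1\<close> or its inverse.

  Moving \<open>w\<close> to the right through \<open>u ^ n\<close>, one factor at a time, gives
  \<open>w u ^ n = q ^ n u ^ n w + (\<Sum>i<n. q ^ (n - 1 - i) u ^ (n - 1 - i) f(v) u ^ i)\<close>, and
  \<open>v ^ j u ^ i = q ^ (- j i) u ^ i v ^ j\<close> turns the error term into
  \<open>q ^ (n - 1) u ^ (n - 1) (\<Sum>j. c\<^sub>j (\<Sum>i<n. q ^ (- (j + 1) i)) v ^ j)\<close>, where \<open>c\<^sub>j\<close> are the
  coefficients of \<open>f\<close>.
  The inner sum runs over the powers of an \<open>n\<close>-th root of unity.  If \<open>n\<close> does not divide
  \<open>j + 1\<close>, this root is different from \<open>1\<close> and the geometric series vanishes; otherwise every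
  summand is \<open>1\<close> and the sum is \<open>n\<close>, which is \<open>0\<close> if the characteristic divides \<open>n\<close>
  (\<open>sum_powers_primitive_root_eq_0\<close>).  So under either hypothesis each \<open>j\<close> in the support of
  \<open>f\<close> contributes zero, and \<open>w\<close> commutes with \<open>u ^ n\<close>.

  Interchanging \<open>u\<close> and \<open>v\<close> and replacing \<open>q\<close> by its inverse preserves the defining relations,
  so the argument is given once, in \<open>power_commutes_if_sums_vanish\<close>, for elements \<open>x\<close>, \<open>y\<close>,
  \<open>z\<close> with \<open>y x = r x y\<close> and \<open>z x = r ^ (- 1) x z + f(y)\<close>: the triple \<open>(u, v, w)\<close> satisfies this
  with \<open>r = q ^ (- 1)\<close> and the triple \<open>(v, u, w)\<close> with \<open>r = q\<close>.
\<close>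

section \<open>Sums of powers of roots of unity\<close>

lemma primitive_root_of_unity_inverse:
  assumes "primitive_root_of_unity n q"
  shows "primitive_root_of_unity n (inverse q)"
  using assms by (auto simp: primitive_root_of_unity_def power_inverse)

lemma primitive_root_of_unity_nonzero:
  assumes "primitive_root_of_unity n q"
  shows "q \<noteq> 0"
  using assms by (auto simp: primitive_root_of_unity_def power_0_left)

lemma primitive_root_of_unity_power_eq_1:
  assumes "primitive_root_of_unity n q" and "q ^ k = 1"
  shows "n dvd k"
proof -
  have "q ^ k = q ^ (n * (k div n)) * q ^ (k mod n)"
    by (metis mult_div_mod_eq power_add)
  also have "\<dots> = q ^ (k mod n)"
    using assms(1) by (simp add: power_mult primitive_root_of_unity_def)
  finally have "q ^ (k mod n) = 1"
    using assms(2) by simp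
  moreover have "k mod n < n"
    using assms(1) by (simp add: primitive_root_of_unity_def)
  ultimately have "k mod n = 0"
    using assms(1) unfolding primitive_root_of_unity_def by (metis gr0I)
  then show ?thesis by (rule mod_0_imp_dvd)
qed

text \<open>
  For \<open>\<zeta> = q ^ k \<noteq> 1\<close> this is the geometric series \<open>(\<zeta> ^ n - 1) / (\<zeta> - 1)\<close>; for
  \<open>\<zeta> = 1\<close> the sum is the image of \<open>n\<close> in the field.
\<close>

lemma sum_powers_primitive_root_eq_0:
  fixes q :: "'a::field"
  assumes "primitive_root_of_unity n q" and "\<not> n dvd k \<or> of_nat n = (0 :: 'a)"
  shows "(\<Sum>i<n. (q ^ k) ^ i) = 0"
proof (cases "q ^ k = 1")
  case True
  then have "n dvd k"
    using assms(1) primitive_root_of_unity_power_eq_1 by blast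
  then show ?thesis
    using True assms(2) by simp
next
  case False
  have "(q ^ k) ^ n = 1"
    using assms(1) by (metis mult.commute power_mult power_one primitive_root_of_unity_def)
  then show ?thesis
    using False by (simp add: sum_gp_strict)
qed

section \<open>Commuting past powers modulo a congruence\<close>

text \<open>
  Computations in a quotient algebra are carried out on representatives, where the arithmetic
  of \<^class>\<open>ring_1\<close> is available; \<open>s\<close> embeds the ground field into the centre.
\<close>

locale algebra_congruence =
  fixes sim :: "'b::ring_1 \<Rightarrow> 'b \<Rightarrow> bool"  (infix \<open>\<approx>\<close> 50)
    and s :: "'a::field \<Rightarrow> 'b"
  assumes sim_refl: "a \<approx> a"
    and sim_sym: "a \<approx> b \<Longrightarrow> b \<approx> a"
    and sim_trans [trans]: "a \<approx> b \<Longrightarrow> b \<approx> c \<Longrightarrow> a \<approx> c"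
    and sim_add: "a \<approx> a' \<Longrightarrow> b \<approx> b' \<Longrightarrow> a + b \<approx> a' + b'"
    and sim_mult: "a \<approx> a' \<Longrightarrow> b \<approx> b' \<Longrightarrow> a * b \<approx> a' * b'"
    and s_add: "s (k + l) = s k + s l"
    and s_mult: "s (k * l) = s k * s l"
    and s_1 [simp]: "s 1 = 1"
    and s_central: "s k * a = a * s k"
begin

lemma sim_mult_left: "a \<approx> b \<Longrightarrow> c * a \<approx> c * b"
  and sim_mult_right: "a \<approx> b \<Longrightarrow> a * c \<approx> b * c"
  by (simp_all add: sim_mult sim_refl)

lemma sim_sum: "(\<And>j. j \<in> A \<Longrightarrow> g j \<approx> h j) \<Longrightarrow> sum g A \<approx> sum h A"
  by (induction A rule: infinite_finite_induct) (auto intro: sim_refl sim_add)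

lemma s_0 [simp]: "s 0 = 0"
  using s_add[of 0 0] by simp

lemma s_left_commute: "b * (s c * d) = s c * (b * d)"
  by (metis mult.assoc s_central)

lemma skew_commute_power_right:
  assumes "y * x \<approx> s r * (x * y)"
  shows "y * x ^ m \<approx> s (r ^ m) * (x ^ m * y)"
proof (induction m)
  case (Suc m)
  have "y * x ^ Suc m = (y * x) * x ^ m"
    by (simp add: mult.assoc)
  also have "\<dots> \<approx> s r * (x * y) * x ^ m"
    by (intro sim_mult_right assms)
  also have "\<dots> = s r * (x * (y * x ^ m))"
    by (simp add: mult.assoc)
  also have "\<dots> \<approx> s r * (x * (s (r ^ m) * (x ^ m * y)))"
    by (intro sim_mult_left Suc.IH)
  also have "\<dots> = s (r ^ Suc m) * (x ^ Suc m * y)"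
    by (simp add: s_mult s_left_commute[of x] mult.assoc)
  finally show ?case .
qed (simp add: sim_refl)

lemma skew_commute_powers:
  assumes "y * x \<approx> s r * (x * y)"
  shows "y ^ j * x ^ m \<approx> s (r ^ (j * m)) * (x ^ m * y ^ j)"
proof (induction j)
  case (Suc j)
  have "y ^ Suc j * x ^ m = y * (y ^ j * x ^ m)"
    by (simp add: mult.assoc)
  also have "\<dots> \<approx> y * (s (r ^ (j * m)) * (x ^ m * y ^ j))"
    by (intro sim_mult_left Suc.IH)
  also have "\<dots> = s (r ^ (j * m)) * ((y * x ^ m) * y ^ j)"
    by (simp add: s_left_commute[of y] mult.assoc)
  also have "\<dots> \<approx> s (r ^ (j * m)) * (s (r ^ m) * (x ^ m * y) * y ^ j)"
    by (intro sim_mult_left sim_mult_right skew_commute_power_right assms)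
  also have "\<dots> = s (r ^ (Suc j * m)) * (x ^ m * y ^ Suc j)"
    by (metis (no_types, lifting) add.commute mult.assoc mult_Suc power_Suc power_add s_mult)
  finally show ?case .
qed (simp add: sim_refl)

text \<open>
  Moving \<open>z\<close> past one factor \<open>x\<close> at a time leaves behind one copy of the inhomogeneous term for
  each factor.  Collecting these with \<open>x\<close> to the left of \<open>y\<close>, the copy with \<open>i\<close> factors \<open>x\<close>
  to its right contributes to \<open>y ^ j\<close> a factor \<open>r ^ (j i)\<close> from the skew commutation and
  \<open>r ^ (i - m)\<close> from the \<open>m - i\<close> factors already passed; together they are \<open>r ^ (- m)\<close> times
  the \<open>i\<close>-th power of \<open>r ^ (j + 1)\<close>.
\<close>

lemma inhomogeneous_commute_power:
  assumes "r \<noteq> 0" and yx: "y * x \<approx> s r * (x * y)"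
    and zx: "z * x \<approx> s (inverse r) * (x * z) + (\<Sum>j\<le>d. s (c j) * y ^ j)"
  shows "z * x ^ Suc m \<approx> s (inverse r ^ Suc m) * (x ^ Suc m * z) +
     x ^ m * (\<Sum>j\<le>d. s (c j * (inverse r ^ m * (\<Sum>i<Suc m. (r ^ Suc j) ^ i))) * y ^ j)"
proof (induction m)
  case 0
  show ?case using zx by simp
next
  case (Suc m)
  \<comment> \<open>The new factor \<open>x\<close> is split off on the left: passing it multiplies the old coefficients by
    \<open>r ^ (- 1)\<close> and creates the copy with \<open>m + 1\<close> factors to its right.\<close>
  define g where "g k j = inverse r ^ k * (\<Sum>i<Suc k. (r ^ Suc j) ^ i)" for k j
  have g_Suc: "inverse r * g m j + r ^ (j * Suc m) = g (Suc m) j" for j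
  proof -
    have "r ^ (j * Suc m) = inverse r ^ Suc m * (r ^ Suc j) ^ Suc m"
    proof -
      have "inverse r * r ^ Suc j = r ^ j"
        using \<open>r \<noteq> 0\<close> by simp
      then show ?thesis
        by (metis power_mult power_mult_distrib)
    qed
    then show ?thesis
      by (simp only: g_def sum.lessThan_Suc[of _ "Suc m"] distrib_left power_Suc[of "inverse r" m]
            mult.assoc)
  qed
  have IH: "z * x ^ Suc m \<approx> s (inverse r ^ Suc m) * (x ^ Suc m * z) +
      x ^ m * (\<Sum>j\<le>d. s (c j * g m j) * y ^ j)"
    using Suc.IH by (simp only: g_def)
  have "(\<Sum>j\<le>d. s (c j) * y ^ j) * x ^ Suc m = (\<Sum>j\<le>d. s (c j) * (y ^ j * x ^ Suc m))"
    by (simp add: sum_distrib_right mult.assoc)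
  also have "\<dots> \<approx> (\<Sum>j\<le>d. s (c j) * (s (r ^ (j * Suc m)) * (x ^ Suc m * y ^ j)))"
    by (intro sim_sum sim_mult_left skew_commute_powers yx)
  also have "\<dots> = x ^ Suc m * (\<Sum>j\<le>d. s (c j * r ^ (j * Suc m)) * y ^ j)"
    by (simp only: sum_distrib_left s_mult s_left_commute[of "x ^ Suc m"] mult.assoc)
  finally have tail: "(\<Sum>j\<le>d. s (c j) * y ^ j) * x ^ Suc m \<approx>
      x ^ Suc m * (\<Sum>j\<le>d. s (c j * r ^ (j * Suc m)) * y ^ j)" .
  have "z * x ^ Suc (Suc m) = (z * x) * x ^ Suc m"
    by (simp add: mult.assoc)
  also have "\<dots> \<approx> (s (inverse r) * (x * z) + (\<Sum>j\<le>d. s (c j) * y ^ j)) * x ^ Suc m"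
    by (intro sim_mult_right zx)
  also have "\<dots> = s (inverse r) * (x * (z * x ^ Suc m)) + (\<Sum>j\<le>d. s (c j) * y ^ j) * x ^ Suc m"
    by (simp only: distrib_right mult.assoc)
  also have "\<dots> \<approx> s (inverse r) * (x * (s (inverse r ^ Suc m) * (x ^ Suc m * z) +
        x ^ m * (\<Sum>j\<le>d. s (c j * g m j) * y ^ j))) +
      x ^ Suc m * (\<Sum>j\<le>d. s (c j * r ^ (j * Suc m)) * y ^ j)"
    by (intro sim_add sim_mult_left IH tail)
  also have "\<dots> = s (inverse r ^ Suc (Suc m)) * (x ^ Suc (Suc m) * z) +
      x ^ Suc m * (s (inverse r) * (\<Sum>j\<le>d. s (c j * g m j) * y ^ j) +
        (\<Sum>j\<le>d. s (c j * r ^ (j * Suc m)) * y ^ j))"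
    by (simp only: distrib_left s_left_commute[of x] s_left_commute[of "x ^ m"]
          mult.assoc power_Suc s_mult add.assoc)
  also have "s (inverse r) * (\<Sum>j\<le>d. s (c j * g m j) * y ^ j) +
        (\<Sum>j\<le>d. s (c j * r ^ (j * Suc m)) * y ^ j) = (\<Sum>j\<le>d. s (c j * g (Suc m) j) * y ^ j)"
  proof -
    have "s (inverse r) * (s (c j * g m j) * y ^ j) + s (c j * r ^ (j * Suc m)) * y ^ j =
        s (c j * g (Suc m) j) * y ^ j" for j
    proof -
      have "s (inverse r) * (s (c j * g m j) * y ^ j) = s (c j * (inverse r * g m j)) * y ^ j"
        by (metis mult.assoc mult.left_commute s_mult)
      then show ?thesis
        unfolding g_Suc[symmetric] by (simp only: distrib_left distrib_right s_add)
    qed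
    then show ?thesis
      by (simp only: sum_distrib_left sum.distrib[symmetric])
  qed
  finally show ?case by (simp only: g_def)
qed

lemma power_commutes_if_sums_vanish:
  assumes "n > 0" and "r ^ n = 1"
    and "y * x \<approx> s r * (x * y)"
    and "z * x \<approx> s (inverse r) * (x * z) + (\<Sum>j\<le>d. s (c j) * y ^ j)"
    and "\<And>j. c j \<noteq> 0 \<Longrightarrow> (\<Sum>i<n. (r ^ Suc j) ^ i) = 0"
  shows "z * x ^ n \<approx> x ^ n * z"
proof -
  obtain m where n: "n = Suc m"
    using \<open>n > 0\<close> gr0_implies_Suc by blast
  have "r \<noteq> 0"
    using assms(1,2) by (auto simp: power_0_left)
  have "c j * (inverse r ^ m * (\<Sum>i<Suc m. (r ^ Suc j) ^ i)) = 0" for j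
    using assms(5)[of j] unfolding n by (metis mult_zero_left mult_zero_right)
  then have "z * x ^ n \<approx> s (inverse r ^ n) * (x ^ n * z)"
    using inhomogeneous_commute_power[OF \<open>r \<noteq> 0\<close> assms(3,4), of m] unfolding n
    by (simp only: s_0 mult_zero_left mult_zero_right sum.neutral_const add_0_right)
  moreover have "inverse r ^ n = 1"
    using \<open>r ^ n = 1\<close> by (simp add: power_inverse)
  ultimately show ?thesis by simp
qed

end

section \<open>The free algebra\<close>

lemma scalar_mult: "scalar (c * d) = scalar c * scalar d"
  by (simp add: scalar_def mult_single)

lemma free_alg_single_induct [case_names single add]:
  assumes single: "\<And>w c. P (Poly_Mapping.single w c)"
    and add: "\<And>a b. P a \<Longrightarrow> P b \<Longrightarrow> P (a + b)"
  shows "P (a :: 'a::field free_alg)"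
proof (induction a rule: update_induct)
  case const
  show ?case using single[of 0 0] by simp
next
  case (update a w c)
  have "Poly_Mapping.update w c a = a + Poly_Mapping.single w c"
    using update.hyps
    by (intro poly_mapping_eqI) (auto simp: lookup_update lookup_add lookup_single in_keys_iff)
  then show ?case using add update.IH single by metis
qed

lemma scalar_commute: "scalar c * a = a * scalar c"
  by (induction a rule: free_alg_single_induct)
    (simp_all add: scalar_def mult_single mult.commute distrib_left distrib_right)

text \<open>
  The free algebra is generated by the generators and scalars, in the form that reduces
  centrality in a quotient to commuting with the generators.
\<close>

lemma free_alg_induct [case_names scalar gen add mult]:
  assumes scalar: "\<And>c. P (scalar c)" and gen: "\<And>g. P (gen g)"
    and add: "\<And>a b. P a \<Longrightarrow> P b \<Longrightarrow> P (a + b)" and mult: "\<And>a b. P a \<Longrightarrow> P b \<Longrightarrow> P (a * b)"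
  shows "P (a :: 'a::field free_alg)"
proof (induction a rule: free_alg_single_induct)
  case (single w c)
  have "P (Poly_Mapping.single (Word l) c)" for l
  proof (induction l)
    case Nil
    show ?case using scalar[of c] by (simp add: scalar_def zero_free_word_def)
  next
    case (Cons g l)
    have "Poly_Mapping.single (Word (g # l)) c = gen g * Poly_Mapping.single (Word l) c"
      by (simp add: gen_def mult_single)
    then show ?case using gen mult Cons by metis
  qed
  then show ?case by (cases w) simp
qed (rule add)

section \<open>The quotient by the defining relations\<close>

lemma ring_of_type_algebra_simps [simp]:
  "carrier ring_of_type_algebra = UNIV"
  "monoid.mult ring_of_type_algebra = (*)"
  "one ring_of_type_algebra = 1"
  "ring.zero ring_of_type_algebra = 0"
  "ring.add ring_of_type_algebra = (+)"
  by (simp_all add: ring_of_type_algebra_def fun_eq_iff)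

lemma ring_ring_of_type_algebra: "ring (ring_of_type_algebra :: 'b::ring_1 ring)"
proof -
  have "\<exists>y. x + y = 0" for x :: 'b
    using add.right_inverse by blast
  then show ?thesis
    unfolding ring_of_type_algebra_def using add.right_inverse
    by unfold_locales (auto simp: algebra_simps Units_def)
qed

lemma nat_pow_ring_of_type_algebra:
  "x [^]\<^bsub>ring_of_type_algebra\<^esub> (n :: nat) = (x :: 'b::ring_1) ^ n"
proof -
  interpret ring "ring_of_type_algebra :: 'b ring"
    by (rule ring_ring_of_type_algebra)
  show ?thesis
    by (induction n) (simp_all add: power_commutes)
qed

lemma ideal_B_ideal: "ideal (B_ideal q f) ring_of_type_algebra"
  unfolding B_ideal_def
  by (rule ring.genideal_ideal[OF ring_ring_of_type_algebra]) simp

abbreviation B_class :: "'a::field \<Rightarrow> 'a poly \<Rightarrow> 'a free_alg \<Rightarrow> 'a free_alg set" where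
  "B_class q f \<equiv> a_r_coset ring_of_type_algebra (B_ideal q f)"

lemma B_class_hom: "ring_hom_ring ring_of_type_algebra (B_alg q f) (B_class q f)"
  unfolding B_alg_def by (rule ideal.rcos_ring_hom_ring[OF ideal_B_ideal])

lemma B_class_mult: "B_class q f (a * b) = B_class q f a \<otimes>\<^bsub>B_alg q f\<^esub> B_class q f b"
proof -
  interpret ring_hom_ring ring_of_type_algebra "B_alg q f" "B_class q f"
    by (rule B_class_hom)
  show ?thesis using hom_mult[of a b] by simp
qed

lemma B_class_add: "B_class q f (a + b) = B_class q f a \<oplus>\<^bsub>B_alg q f\<^esub> B_class q f b"
proof -
  interpret ring_hom_ring ring_of_type_algebra "B_alg q f" "B_class q f"
    by (rule B_class_hom)
  show ?thesis using hom_add[of a b] by simp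
qed

lemma B_class_power: "B_class q f (a ^ n) = B_class q f a [^]\<^bsub>B_alg q f\<^esub> n"
proof -
  interpret ring_hom_ring ring_of_type_algebra "B_alg q f" "B_class q f"
    by (rule B_class_hom)
  show ?thesis
    using hom_nat_pow[of a n] by (simp add: nat_pow_ring_of_type_algebra)
qed

lemma carrier_B_alg: "carrier (B_alg q f) = range (B_class q f)"
  by (auto simp: B_alg_def FactRing_def A_RCOSETS_defs a_r_coset_defs)

lemma algebra_congruence_B_class:
  "algebra_congruence (\<lambda>a b. B_class q f a = B_class q f b) scalar"
proof
  show "scalar (k + l) = scalar k + scalar l" for k l :: 'a
    by (simp add: scalar_def single_add)
  show "scalar (1 :: 'a) = 1"
    by (simp add: scalar_def)
qed (simp_all add: B_class_add B_class_mult scalar_mult, rule scalar_commute)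

lemma B_class_relation:
  assumes "a - b \<in> B_relations q f"
  shows "B_class q f a = B_class q f b"
proof -
  interpret ideal "B_ideal q f" "ring_of_type_algebra :: 'a free_alg ring"
    by (rule ideal_B_ideal)
  have "a - b \<in> B_ideal q f"
    using assms genideal_self[of "B_relations q f"] unfolding B_ideal_def by auto
  then have "a \<in> B_class q f b"
    by (auto simp: a_r_coset_defs intro!: bexI[of _ "a - b"])
  then show ?thesis
    using a_repr_independence'[of a b] by simp
qed

text \<open>The centralizer of an element is a subalgebra, so it is everything
  once it contains the generators.\<close>

lemma B_class_central_if_commutes_with_gens:
  assumes "\<And>g. B_class q f (gen g * x) = B_class q f (x * gen g)"
  shows "B_class q f x \<in> ring_center (B_alg q f)"
proof -
  interpret algebra_congruence "\<lambda>a b. B_class q f a = B_class q f b" scalar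
    by (rule algebra_congruence_B_class)
  have "B_class q f (a * x) = B_class q f (x * a)" for a
  proof (induction a rule: free_alg_induct)
    case (scalar c)
    show ?case by (rule arg_cong[OF scalar_commute])
  next
    case (gen g)
    show ?case by (rule assms)
  next
    case (add a b)
    then show ?case unfolding distrib_left distrib_right by (rule sim_add)
  next
    case (mult a b)
    have "B_class q f (a * b * x) = B_class q f (a * (b * x))"
      by (simp add: mult.assoc)
    also have "\<dots> = B_class q f (a * (x * b))"
      by (intro sim_mult_left mult)
    also have "\<dots> = B_class q f (a * x * b)"
      by (simp add: mult.assoc)
    also have "\<dots> = B_class q f (x * a * b)"
      by (intro sim_mult_right mult)
    finally show ?case by (simp add: mult.assoc)
  qed
  then show ?thesis
    by (auto simp: ring_center_def carrier_B_alg simp flip: B_class_mult)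
qed

theorem lemma9p14:
  fixes q :: "'a::alg_closed_field"
    and f :: "'a poly"
    and n p :: nat
  assumes "CHAR('a) = p" and "p > 0"
    and "primitive_root_of_unity n q"
    and "(\<forall>j \<in> poly_supp f. \<not> n dvd (j + 1)) \<or> p dvd n"
  shows "B_gen q f GenU [^]\<^bsub>B_alg q f\<^esub> n \<in> ring_center (B_alg q f)
       \<and> B_gen q f GenV [^]\<^bsub>B_alg q f\<^esub> n \<in> ring_center (B_alg q f)"
proof -
  interpret algebra_congruence "\<lambda>a b. B_class q f a = B_class q f b" scalar
    by (rule algebra_congruence_B_class)
  let ?u = "gen GenU :: 'a free_alg" and ?v = "gen GenV :: 'a free_alg"
    and ?w = "gen GenW :: 'a free_alg"
  have q: "q \<noteq> 0" "n > 0" "q ^ n = 1" "inverse q ^ n = 1"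
    using assms(3) primitive_root_of_unity_inverse[OF assms(3)] primitive_root_of_unity_nonzero
    by (auto simp: primitive_root_of_unity_def)
  have dvd: "\<not> n dvd Suc j \<or> of_nat n = (0 :: 'a)" if "Polynomial.coeff f j \<noteq> 0" for j
    using assms(1,4) that by (auto simp: poly_supp_def of_nat_eq_0_iff_char_dvd)
  note vanish = sum_powers_primitive_root_eq_0[OF assms(3) dvd]
    sum_powers_primitive_root_eq_0[OF primitive_root_of_unity_inverse[OF assms(3)] dvd]

  have uv: "B_class q f (?u * ?v) = B_class q f (scalar q * (?v * ?u))"
    by (rule B_class_relation) (simp add: B_relations_def Let_def)
  have wu: "B_class q f (?w * ?u) = B_class q f (scalar q * (?u * ?w) + eval_at f ?v)"
    by (rule B_class_relation) (simp add: B_relations_def Let_def)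
  have wv: "B_class q f (?w * ?v) = B_class q f (scalar (inverse q) * (?v * ?w) + eval_at f ?u)"
    by (rule B_class_relation) (simp add: B_relations_def Let_def)
  \<comment> \<open>The first relation solved for \<open>v u\<close>, so that it has the form needed for \<open>(u, v, w)\<close>.\<close>
  have vu: "B_class q f (?v * ?u) = B_class q f (scalar (inverse q) * (?u * ?v))"
  proof -
    have "scalar (inverse q) * (scalar q * (?v * ?u)) = ?v * ?u"
      using q(1) by (simp flip: mult.assoc s_mult)
    then show ?thesis
      using sim_mult_left[OF uv, of "scalar (inverse q)"] by metis
  qed

  have "B_class q f (gen g * ?u ^ n) = B_class q f (?u ^ n * gen g)" for g
  proof (cases g)
    case GenU
    then show ?thesis by (simp add: power_commutes)
  next
    case GenV
    then show ?thesis
      using skew_commute_power_right[OF vu, of n] q by simp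
  next
    case GenW
    then show ?thesis
      using power_commutes_if_sums_vanish[where r = "inverse q" and y = ?v and x = ?u and z = ?w and n = n
          and c = "Polynomial.coeff f" and d = "Polynomial.degree f"]
        q vu wu vanish(2) by (simp add: eval_at_def)
  qed
  moreover have "B_class q f (gen g * ?v ^ n) = B_class q f (?v ^ n * gen g)" for g
  proof (cases g)
    case GenU
    then show ?thesis
      using skew_commute_power_right[OF uv, of n] q by simp
  next
    case GenV
    then show ?thesis by (simp add: power_commutes)
  next
    case GenW
    then show ?thesis
      using power_commutes_if_sums_vanish[where r = q and y = ?u and x = ?v and z = ?w and n = n
          and c = "Polynomial.coeff f" and d = "Polynomial.degree f"]
        q uv wv vanish(1) by (simp add: eval_at_def)
  qed
  ultimately show ?thesis
    unfolding B_gen_def B_class_power[symmetric] by (blast intro: B_class_central_if_commutes_with_gens)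
qed

end
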